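(* Let $R$ be a noetherian ring and let $\sigma$ be an automorphism of $R$. Let $P$ and $Q$ be prime ideals of $R$ that are $\sigma$-semistable, and suppose that there is a link $Q \to P$. Then there is a link $Q^0 \to P^0$ between the semiprime ideals $Q^0$ and $P^0$ of $R$, where $Q^0$ and $P^0$ are the $\sigma$-invariant parts of $Q$ and $P$.
   Context: All rings have an identity element and all modules are unitary; noetherian means left and right noetherian; ideal means two-sided ideal. An ideal $I$ of $R$ is $\sigma$-semistable if there is an integer $n \geq 1$ with $\sigma^n(I) = I$, and $\sigma$-invariant if $\sigma(I) = I$. For a $\sigma$-semistable ideal $I$ with $\sigma^n(I)=I$, $n \ge 1$, the $\sigma$-invariant part of $I$ is $I^0 = I \cap \sigma(I) \cap \cdots \cap \sigma^{n-1}(I)$, which is the largest $\sigma$-invariant ideal contained in $I$; if $I$ is prime, then $I^0$ is a semiprime ideal. A right (left) module over a semiprime noetherian ring $S$ is torsionfree if no nonzero element of it is annihilated by a regular element of $S$. For prime ideals $Q, P$ of $R$, there is a link $Q \to P$ if there is an ideal $A$ of $R$ with $QP \subseteq A \subsetneq Q \cap P$ such that $(Q \cap P)/A$ is torsionfree as a left $R/Q$-module and as a right $R/P$-module. For $\sigma$-semistable prime ideals $Q, P$ of $R$, there is a link $Q^0 \to P^0$ if there is an ideal $A$ of $R$ with $Q^0P^0 \subseteq A \subsetneq Q^0 \cap P^0$ such that $(Q^0 \cap P^0)/A$ is torsionfree as a left $R/Q^0$-module and as a right $R/P^0$-module. *)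

theory Defs
  imports "HOL-Algebra.QuotRing" "HOL-Algebra.Ideal_Product" "HOL-Algebra.Module"
begin

section \<open>Noetherian rings, prime and semiprime ideals\<close>

text \<open>
  Rings are not assumed to be commutative. The library's \<^locale>\<open>ideal\<close> is two-sided, and
  \<^const>\<open>ideal_prod\<close> consists of the finite sums of products. The library's
  \<^locale>\<open>primeideal\<close> and \<^locale>\<open>module\<close> require commutativity and
  \<open>noetherian_ring\<close> concerns two-sided ideals only, so none of them applies here.
\<close>

definition left_ideal :: "'a set \<Rightarrow> ('a, 'b) ring_scheme \<Rightarrow> bool" where
  "left_ideal I R \<longleftrightarrow> additive_subgroup I R \<and> (\<forall>r\<in>carrier R. \<forall>x\<in>I. r \<otimes>\<^bsub>R\<^esub> x \<in> I)"

definition right_ideal :: "'a set \<Rightarrow> ('a, 'b) ring_scheme \<Rightarrow> bool" where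
  "right_ideal I R \<longleftrightarrow> additive_subgroup I R \<and> (\<forall>r\<in>carrier R. \<forall>x\<in>I. x \<otimes>\<^bsub>R\<^esub> r \<in> I)"

definition left_noetherian :: "('a, 'b) ring_scheme \<Rightarrow> bool" where
  "left_noetherian R \<longleftrightarrow>
     (\<forall>C :: nat \<Rightarrow> 'a set. (\<forall>n. left_ideal (C n) R) \<and> (\<forall>n. C n \<subseteq> C (Suc n)) \<longrightarrow>
        (\<exists>N. \<forall>n\<ge>N. C n = C N))"

definition right_noetherian :: "('a, 'b) ring_scheme \<Rightarrow> bool" where
  "right_noetherian R \<longleftrightarrow>
     (\<forall>C :: nat \<Rightarrow> 'a set. (\<forall>n. right_ideal (C n) R) \<and> (\<forall>n. C n \<subseteq> C (Suc n)) \<longrightarrow>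
        (\<exists>N. \<forall>n\<ge>N. C n = C N))"

definition noetherian :: "('a, 'b) ring_scheme \<Rightarrow> bool" where
  "noetherian R \<longleftrightarrow> left_noetherian R \<and> right_noetherian R"

definition prime_ideal :: "'a set \<Rightarrow> ('a, 'b) ring_scheme \<Rightarrow> bool" where
  "prime_ideal P R \<longleftrightarrow> ideal P R \<and> P \<noteq> carrier R \<and>
     (\<forall>A B. ideal A R \<and> ideal B R \<and> A \<cdot>\<^bsub>R\<^esub> B \<subseteq> P \<longrightarrow> A \<subseteq> P \<or> B \<subseteq> P)"

definition semiprime_ideal :: "'a set \<Rightarrow> ('a, 'b) ring_scheme \<Rightarrow> bool" where
  "semiprime_ideal I R \<longleftrightarrow> ideal I R \<and> (\<forall>A. ideal A R \<and> A \<cdot>\<^bsub>R\<^esub> A \<subseteq> I \<longrightarrow> A \<subseteq> I)"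


section \<open>Semistable ideals and their invariant parts\<close>

definition semistable :: "('a \<Rightarrow> 'a) \<Rightarrow> 'a set \<Rightarrow> bool" where
  "semistable \<sigma> I \<longleftrightarrow> (\<exists>n\<ge>1. (\<sigma> ^^ n) ` I = I)"

text \<open>
  The intersection does not depend on which \<open>n \<ge> 1\<close> with \<open>\<sigma>\<^sup>n(I) = I\<close> is taken (lemma
  \<open>invariant_part_eq\<close>); the least one is used to have a function of \<open>\<sigma>\<close> and \<open>I\<close> alone.
\<close>

definition invariant_part :: "('a \<Rightarrow> 'a) \<Rightarrow> 'a set \<Rightarrow> 'a set" where
  "invariant_part \<sigma> I = (\<Inter>i<(LEAST n. n \<ge> 1 \<and> (\<sigma> ^^ n) ` I = I). (\<sigma> ^^ i) ` I)"


section \<open>Torsionfree modules\<close>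

text \<open>
  For both left and right modules, \<open>s \<odot> x\<close> is the action of the scalar \<open>s\<close> on \<open>x\<close>; over a right
  module it stands for \<open>x s\<close>. As for the library's \<^locale>\<open>module\<close>, the multiplication and unit
  components of the record carrying a module play no role.
\<close>

locale left_module = R?: ring R + M?: abelian_group M
  for R :: "('a, 'c) ring_scheme" (structure) and M :: "('a, 'b, 'd) module_scheme" (structure) +
  assumes smult_closed: "\<lbrakk>a \<in> carrier R; x \<in> carrier M\<rbrakk> \<Longrightarrow> a \<odot>\<^bsub>M\<^esub> x \<in> carrier M"
    and smult_l_distr: "\<lbrakk>a \<in> carrier R; b \<in> carrier R; x \<in> carrier M\<rbrakk> \<Longrightarrow>
      (a \<oplus>\<^bsub>R\<^esub> b) \<odot>\<^bsub>M\<^esub> x = a \<odot>\<^bsub>M\<^esub> x \<oplus>\<^bsub>M\<^esub> b \<odot>\<^bsub>M\<^esub> x"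
    and smult_r_distr: "\<lbrakk>a \<in> carrier R; x \<in> carrier M; y \<in> carrier M\<rbrakk> \<Longrightarrow>
      a \<odot>\<^bsub>M\<^esub> (x \<oplus>\<^bsub>M\<^esub> y) = a \<odot>\<^bsub>M\<^esub> x \<oplus>\<^bsub>M\<^esub> a \<odot>\<^bsub>M\<^esub> y"
    and smult_assoc: "\<lbrakk>a \<in> carrier R; b \<in> carrier R; x \<in> carrier M\<rbrakk> \<Longrightarrow>
      (a \<otimes>\<^bsub>R\<^esub> b) \<odot>\<^bsub>M\<^esub> x = a \<odot>\<^bsub>M\<^esub> (b \<odot>\<^bsub>M\<^esub> x)"
    and smult_one: "x \<in> carrier M \<Longrightarrow> \<one>\<^bsub>R\<^esub> \<odot>\<^bsub>M\<^esub> x = x"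

locale right_module = R?: ring R + M?: abelian_group M
  for R :: "('a, 'c) ring_scheme" (structure) and M :: "('a, 'b, 'd) module_scheme" (structure) +
  assumes smult_closed: "\<lbrakk>a \<in> carrier R; x \<in> carrier M\<rbrakk> \<Longrightarrow> a \<odot>\<^bsub>M\<^esub> x \<in> carrier M"
    and smult_l_distr: "\<lbrakk>a \<in> carrier R; b \<in> carrier R; x \<in> carrier M\<rbrakk> \<Longrightarrow>
      (a \<oplus>\<^bsub>R\<^esub> b) \<odot>\<^bsub>M\<^esub> x = a \<odot>\<^bsub>M\<^esub> x \<oplus>\<^bsub>M\<^esub> b \<odot>\<^bsub>M\<^esub> x"
    and smult_r_distr: "\<lbrakk>a \<in> carrier R; x \<in> carrier M; y \<in> carrier M\<rbrakk> \<Longrightarrow>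
      a \<odot>\<^bsub>M\<^esub> (x \<oplus>\<^bsub>M\<^esub> y) = a \<odot>\<^bsub>M\<^esub> x \<oplus>\<^bsub>M\<^esub> a \<odot>\<^bsub>M\<^esub> y"
    and smult_assoc: "\<lbrakk>a \<in> carrier R; b \<in> carrier R; x \<in> carrier M\<rbrakk> \<Longrightarrow>
      (a \<otimes>\<^bsub>R\<^esub> b) \<odot>\<^bsub>M\<^esub> x = b \<odot>\<^bsub>M\<^esub> (a \<odot>\<^bsub>M\<^esub> x)"
    and smult_one: "x \<in> carrier M \<Longrightarrow> \<one>\<^bsub>R\<^esub> \<odot>\<^bsub>M\<^esub> x = x"

definition regular_element :: "('a, 'b) ring_scheme \<Rightarrow> 'a \<Rightarrow> bool" where
  "regular_element S s \<longleftrightarrow> s \<in> carrier S \<and>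
     (\<forall>x\<in>carrier S. s \<otimes>\<^bsub>S\<^esub> x = \<zero>\<^bsub>S\<^esub> \<longrightarrow> x = \<zero>\<^bsub>S\<^esub>) \<and>
     (\<forall>x\<in>carrier S. x \<otimes>\<^bsub>S\<^esub> s = \<zero>\<^bsub>S\<^esub> \<longrightarrow> x = \<zero>\<^bsub>S\<^esub>)"

definition torsionfree :: "('s, 'c) ring_scheme \<Rightarrow> ('s, 'm, 'd) module_scheme \<Rightarrow> bool" where
  "torsionfree S M \<longleftrightarrow>
     (\<forall>x\<in>carrier M. x \<noteq> \<zero>\<^bsub>M\<^esub> \<longrightarrow> \<not> (\<exists>s. regular_element S s \<and> s \<odot>\<^bsub>M\<^esub> x = \<zero>\<^bsub>M\<^esub>))"


section \<open>Links\<close>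

text \<open>
  The quotient \<open>N/A\<close> of ideals \<open>A \<subseteq> N\<close>, with the cosets of an ideal acting on it from the left
  and from the right. If \<open>I N \<subseteq> A\<close>, then \<open>(I + r) (A + x) = A + r x\<close> (lemma
  \<open>left_quotient_smult\<close>), and \<open>N/A\<close> is a left module over \<open>R/I\<close>; symmetrically on the right.
\<close>

definition left_quotient :: "('a, 'b) ring_scheme \<Rightarrow> 'a set \<Rightarrow> 'a set \<Rightarrow> ('a set, 'a set) module" where
  "left_quotient R N A =
     \<lparr>carrier = (\<lambda>x. A +>\<^bsub>R\<^esub> x) ` N, mult = rcoset_mult R A, one = A +>\<^bsub>R\<^esub> \<one>\<^bsub>R\<^esub>,
      zero = A, add = set_add R, smult = (\<lambda>s x. rcoset_mult R A s x)\<rparr>"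

definition right_quotient :: "('a, 'b) ring_scheme \<Rightarrow> 'a set \<Rightarrow> 'a set \<Rightarrow> ('a set, 'a set) module" where
  "right_quotient R N A =
     \<lparr>carrier = (\<lambda>x. A +>\<^bsub>R\<^esub> x) ` N, mult = rcoset_mult R A, one = A +>\<^bsub>R\<^esub> \<one>\<^bsub>R\<^esub>,
      zero = A, add = set_add R, smult = (\<lambda>s x. rcoset_mult R A x s)\<rparr>"

text \<open>
  This is used both for prime ideals and for the (semiprime) invariant parts of prime ideals.
\<close>

definition link :: "('a, 'b) ring_scheme \<Rightarrow> 'a set \<Rightarrow> 'a set \<Rightarrow> bool" where
  "link R Q P \<longleftrightarrow>
     (\<exists>A. ideal A R \<and> Q \<cdot>\<^bsub>R\<^esub> P \<subseteq> A \<and> A \<subset> Q \<inter> P \<and>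
        torsionfree (R Quot Q) (left_quotient R (Q \<inter> P) A) \<and>
        torsionfree (R Quot P) (right_quotient R (Q \<inter> P) A))"


section \<open>The definitions behave as intended\<close>

lemma funpow_image_mult:
  assumes "(\<sigma> ^^ n) ` I = I"
  shows "(\<sigma> ^^ (n * k)) ` I = I"
proof (induction k)
  case (Suc k)
  have "(\<sigma> ^^ (n * Suc k)) ` I = (\<sigma> ^^ n) ` ((\<sigma> ^^ (n * k)) ` I)"
    by (simp add: funpow_add image_comp)
  then show ?case using Suc assms by simp
qed simp

lemma funpow_image_mod:
  assumes "(\<sigma> ^^ n) ` I = I"
  shows "(\<sigma> ^^ i) ` I = (\<sigma> ^^ (i mod n)) ` I"
proof -
  have "(\<sigma> ^^ i) ` I = (\<sigma> ^^ (i mod n + n * (i div n))) ` I" by simp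
  also have "\<dots> = (\<sigma> ^^ (i mod n)) ` ((\<sigma> ^^ (n * (i div n))) ` I)"
    by (simp only: funpow_add image_comp)
  finally show ?thesis using funpow_image_mult[OF assms] by simp
qed

lemma invariant_part_eq:
  assumes "n \<ge> 1" "(\<sigma> ^^ n) ` I = I"
  shows "invariant_part \<sigma> I = (\<Inter>i<n. (\<sigma> ^^ i) ` I)"
proof -
  have all: "(\<Inter>i<m. (\<sigma> ^^ i) ` I) = (\<Inter>i. (\<sigma> ^^ i) ` I)" if "m \<ge> 1" "(\<sigma> ^^ m) ` I = I" for m
  proof -
    have "(\<sigma> ^^ i) ` I \<in> (\<lambda>i. (\<sigma> ^^ i) ` I) ` {..<m}" for i
      using funpow_image_mod[OF that(2), of i] that(1) by (intro image_eqI[of _ _ "i mod m"]) auto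
    then have "(\<lambda>i. (\<sigma> ^^ i) ` I) ` {..<m} = range (\<lambda>i. (\<sigma> ^^ i) ` I)" by blast
    then show ?thesis by simp
  qed
  define m where "m = (LEAST n. n \<ge> 1 \<and> (\<sigma> ^^ n) ` I = I)"
  have "m \<ge> 1 \<and> (\<sigma> ^^ m) ` I = I"
    unfolding m_def by (rule LeastI[of _ n]) (rule conjI[OF assms])
  then have "(\<Inter>i<m. (\<sigma> ^^ i) ` I) = (\<Inter>i<n. (\<sigma> ^^ i) ` I)"
    using all[of m] all[OF assms] by (elim conjE) (rule trans[OF _ sym])
  then show ?thesis
    by (simp only: invariant_part_def m_def)
qed

lemma (in ring) ring_iso_funpow:
  assumes "\<sigma> \<in> ring_iso R R"
  shows "(\<sigma> ^^ n) \<in> ring_iso R R"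
proof (induction n)
  case 0
  show ?case by (auto simp: ring_iso_def ring_hom_def bij_betw_def)
next
  case (Suc n)
  show ?case using ring_iso_set_trans[OF Suc assms] by (simp only: funpow.simps)
qed

lemma (in ring) prime_ideal_image:
  assumes "\<sigma> \<in> ring_iso R R" "prime_ideal P R"
  shows "prime_ideal (\<sigma> ` P) R"
proof -
  have P: "ideal P R" "P \<noteq> carrier R" using assms(2) by (auto simp: prime_ideal_def)
  have hom: "\<sigma> \<in> ring_hom R R" and bij: "bij_betw \<sigma> (carrier R) (carrier R)"
    using assms(1) by (auto simp: ring_iso_def)
  interpret h: ring_hom_ring R R \<sigma>
    using hom by (intro ring_hom_ringI2 ring_axioms)
  have sub: "I \<subseteq> carrier R" if "ideal I R" for I
    using ideal.Icarr[OF that] by blast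
  have "ideal (\<sigma> ` P) R"
  proof (rule idealI[OF ring_axioms])
    interpret P: ideal P R by fact
    show "subgroup (\<sigma> ` P) (add_monoid R)"
      by (rule h.img_is_add_subgroup[OF P.a_subgroup])
  next
    fix a x assume "a \<in> \<sigma> ` P" "x \<in> carrier R"
    then obtain p r where pr: "p \<in> P" "a = \<sigma> p" "r \<in> carrier R" "x = \<sigma> r"
      using bij by (metis bij_betw_def imageE)
    have p: "p \<in> carrier R" using sub[OF P(1)] pr(1) by blast
    have "x \<otimes> a = \<sigma> (r \<otimes> p)" "a \<otimes> x = \<sigma> (p \<otimes> r)" using pr p by simp_all
    then show "x \<otimes> a \<in> \<sigma> ` P" "a \<otimes> x \<in> \<sigma> ` P"
      using ideal.I_l_closed[OF P(1) pr(1,3)] ideal.I_r_closed[OF P(1) pr(1,3)] by simp_all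
  qed
  moreover have "\<sigma> ` P \<noteq> carrier R"
    using P(2) sub[OF P(1)] bij by (metis bij_betw_def inj_on_image_eq_iff order_refl)
  moreover have "A \<subseteq> \<sigma> ` P \<or> B \<subseteq> \<sigma> ` P"
    if A: "ideal A R" and B: "ideal B R" and AB: "A \<cdot> B \<subseteq> \<sigma> ` P" for A B
  proof -
    define V where "V J = {r \<in> carrier R. \<sigma> r \<in> J}" for J
    have V: "ideal (V J) R" if "ideal J R" for J
      using h.ideal_vimage[OF that] by (simp add: V_def)
    have inP: "r \<in> P" if "r \<in> carrier R" "\<sigma> r \<in> \<sigma> ` P" for r
      using that bij sub[OF P(1)] by (metis bij_betw_def inj_on_image_mem_iff)
    have mem: "s \<in> carrier R \<and> \<sigma> s \<in> A \<cdot> B" if "s \<in> V A \<cdot> V B" for s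
      using that
    proof (induction rule: ideal_prod.induct)
      case (prod i j)
      then show ?case by (auto simp: V_def intro: ideal_prod.prod)
    next
      case (sum s1 s2)
      then show ?case by (auto intro: ideal_prod.sum)
    qed
    then have "V A \<cdot> V B \<subseteq> P" using AB inP by blast
    then have "V A \<subseteq> P \<or> V B \<subseteq> P"
      using V[OF A] V[OF B] assms(2) by (auto simp: prime_ideal_def)
    moreover have "J \<subseteq> \<sigma> ` P" if VJ: "V J \<subseteq> P" and J: "ideal J R" for J
    proof
      fix y assume y: "y \<in> J"
      then obtain x where "x \<in> carrier R" "y = \<sigma> x"
        using sub[OF J] bij by (metis bij_betw_def imageE subsetD)
      then show "y \<in> \<sigma> ` P" using y VJ by (auto simp: V_def)
    qed
    ultimately show ?thesis using A B by blast
  qed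
  ultimately show ?thesis by (auto simp: prime_ideal_def)
qed

lemma (in ring) semiprime_invariant_part:
  assumes "\<sigma> \<in> ring_iso R R" "prime_ideal P R" "semistable \<sigma> P"
  shows "semiprime_ideal (invariant_part \<sigma> P) R"
proof -
  obtain n where n: "n \<ge> 1" "(\<sigma> ^^ n) ` P = P" using assms(3) by (auto simp: semistable_def)
  have pr: "prime_ideal ((\<sigma> ^^ i) ` P) R" for i
    by (rule prime_ideal_image[OF ring_iso_funpow[OF assms(1)] assms(2)])
  have "ideal (\<Inter>i<n. (\<sigma> ^^ i) ` P) R"
  proof (rule i_Intersect)
    show "(\<lambda>i. (\<sigma> ^^ i) ` P) ` {..<n} \<noteq> {}" using n(1) by (simp add: lessThan_empty_iff)
    fix J assume "J \<in> (\<lambda>i. (\<sigma> ^^ i) ` P) ` {..<n}"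
    then show "ideal J R" using pr by (auto simp: prime_ideal_def)
  qed
  moreover have "\<forall>A. ideal A R \<and> A \<cdot> A \<subseteq> (\<Inter>i<n. (\<sigma> ^^ i) ` P) \<longrightarrow>
    A \<subseteq> (\<Inter>i<n. (\<sigma> ^^ i) ` P)"
  proof (intro allI impI INT_greatest; elim conjE)
    fix A i assume that: "ideal A R" "A \<cdot> A \<subseteq> (\<Inter>i<n. (\<sigma> ^^ i) ` P)" and "i \<in> {..<n}"
    then have "A \<cdot> A \<subseteq> (\<sigma> ^^ i) ` P" using that(2) by blast
    then show "A \<subseteq> (\<sigma> ^^ i) ` P" using that(1) pr[of i] unfolding prime_ideal_def by blast
  qed
  ultimately have "semiprime_ideal (\<Inter>i<n. (\<sigma> ^^ i) ` P) R"
    unfolding semiprime_ideal_def by (rule conjI)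
  then show ?thesis by (simp only: invariant_part_eq[OF n])
qed

lemma (in ring) invariant_part_invariant:
  assumes "\<sigma> \<in> ring_iso R R" "ideal I R" "semistable \<sigma> I"
  shows "\<sigma> ` invariant_part \<sigma> I = invariant_part \<sigma> I"
proof -
  obtain n where n: "n \<ge> 1" "(\<sigma> ^^ n) ` I = I" using assms(3) by (auto simp: semistable_def)
  have bij: "bij_betw (\<sigma> ^^ i) (carrier R) (carrier R)" for i
    using ring_iso_funpow[OF assms(1), of i] by (simp add: ring_iso_def)
  have sub: "I \<subseteq> carrier R" using ideal.Icarr[OF assms(2)] by blast
  have carr: "(\<sigma> ^^ i) ` I \<subseteq> carrier R" for i
    using image_mono[OF sub, of "\<sigma> ^^ i"] bij[of i] by (simp add: bij_betw_def)
  have inj: "inj_on \<sigma> (carrier R)" using bij[of 1] by (simp add: bij_betw_def)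
  have "\<sigma> ` (\<Inter>i<n. (\<sigma> ^^ i) ` I) = (\<Inter>i<n. \<sigma> ` (\<sigma> ^^ i) ` I)"
    by (rule image_INT[OF inj, where j = 0]) (use n(1) carr in auto)
  also have "\<dots> = (\<Inter>i<n. (\<sigma> ^^ Suc i) ` I)" by (simp only: image_comp funpow.simps)
  also have "\<dots> = (\<Inter>i<n. (\<sigma> ^^ i) ` I)"
  proof -
    have "(\<lambda>i. (\<sigma> ^^ Suc i) ` I) ` {..<n} = (\<lambda>i. (\<sigma> ^^ i) ` I) ` (Suc ` {..<n})"
      by (simp only: image_image)
    also have "Suc ` {..<n} = insert n ({..<n} - {0})"
    proof (rule Set.set_eqI)
      show "k \<in> Suc ` {..<n} \<longleftrightarrow> k \<in> insert n ({..<n} - {0})" for k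
        using n(1) by (cases k) auto
    qed
    also have "(\<lambda>i. (\<sigma> ^^ i) ` I) ` \<dots> = (\<lambda>i. (\<sigma> ^^ i) ` I) ` insert 0 ({..<n} - {0})"
      by (simp only: image_insert n(2) funpow.simps image_id id_apply)
    also have "insert 0 ({..<n} - {0}) = {..<n}" using n(1) by auto
    finally show ?thesis by (simp only:)
  qed
  finally show ?thesis by (simp only: invariant_part_eq[OF n])
qed

lemma (in ring) invariant_part_greatest:
  assumes "semistable \<sigma> I" "J \<subseteq> I" "\<sigma> ` J = J"
  shows "J \<subseteq> invariant_part \<sigma> I"
proof -
  obtain n where n: "n \<ge> 1" "(\<sigma> ^^ n) ` I = I" using assms(1) by (auto simp: semistable_def)
  have "(\<sigma> ^^ i) ` J = J" for i
    using funpow_image_mult[where n = 1 and k = i and I = J and \<sigma> = \<sigma>] assms(3) by simp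
  then have "J \<subseteq> (\<sigma> ^^ i) ` I" for i using assms(2) by (metis image_mono)
  then have "J \<subseteq> (\<Inter>i<n. (\<sigma> ^^ i) ` I)" by (intro INT_greatest)
  then show ?thesis by (simp only: invariant_part_eq[OF n])
qed

context ring
begin

lemma coset_rep:
  assumes "y \<in> A +> x"
  obtains a where "a \<in> A" "y = a \<oplus> x"
  using assms unfolding a_r_coset_def' by blast

lemma coset_absorb:
  assumes "ideal A R" "x \<in> carrier R" "a \<in> A"
  shows "A +> (a \<oplus> x) = A +> x"
proof -
  interpret A: ideal A R by fact
  have "a \<oplus> x \<in> A +> x" using assms(3) by (auto simp: a_r_coset_def')
  then show ?thesis using A.a_repr_independence'[of _ x] assms(2) by metis
qed

lemma left_quotient_smult:
  assumes I: "ideal I R" and N: "ideal N R" and A: "ideal A R"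
    and AN: "A \<subseteq> N" and IN: "I \<cdot> N \<subseteq> A"
    and r: "r \<in> carrier R" and x: "x \<in> N"
  shows "(I +> r) \<odot>\<^bsub>left_quotient R N A\<^esub> (A +> x) = A +> (r \<otimes> x)"
proof -
  interpret I: ideal I R by fact
  interpret N: ideal N R by fact
  interpret A: ideal A R by fact
  have xc: "x \<in> carrier R" using x by simp
  have key: "A +> (s \<otimes> y) = A +> (r \<otimes> x)" if s: "s \<in> I +> r" and y: "y \<in> A +> x" for s y
  proof -
    obtain i where i: "i \<in> I" "s = i \<oplus> r" using coset_rep[OF s] by metis
    obtain a where a: "a \<in> A" "y = a \<oplus> x" using coset_rep[OF y] by metis
    have c: "i \<in> carrier R" "a \<in> carrier R" using i a by auto
    have yN: "a \<oplus> x \<in> N" using a x AN by blast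
    have "i \<otimes> (a \<oplus> x) \<in> A" using ideal_prod.prod[OF i(1) yN, of R] IN by blast
    moreover have "r \<otimes> a \<in> A" using a r by (simp add: A.I_l_closed)
    ultimately have "i \<otimes> (a \<oplus> x) \<oplus> r \<otimes> a \<in> A" by simp
    moreover have "s \<otimes> y = (i \<otimes> (a \<oplus> x) \<oplus> r \<otimes> a) \<oplus> r \<otimes> x"
      using c r xc i a by (simp add: l_distr r_distr a_ac)
    ultimately show ?thesis using coset_absorb[OF A] r xc by simp
  qed
  have "r \<in> I +> r" "x \<in> A +> x" using r xc by (auto intro: I.a_rcos_self A.a_rcos_self)
  then have "I +> r \<noteq> {}" "A +> x \<noteq> {}" by blast+
  moreover have "rcoset_mult R A (I +> r) (A +> x) = (\<Union>s\<in>I +> r. \<Union>y\<in>A +> x. A +> (r \<otimes> x))"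
    unfolding rcoset_mult_def using key by (intro SUP_cong refl)
  ultimately show ?thesis by (simp add: left_quotient_def)
qed

lemma right_quotient_smult:
  assumes I: "ideal I R" and N: "ideal N R" and A: "ideal A R"
    and AN: "A \<subseteq> N" and NI: "N \<cdot> I \<subseteq> A"
    and r: "r \<in> carrier R" and x: "x \<in> N"
  shows "(I +> r) \<odot>\<^bsub>right_quotient R N A\<^esub> (A +> x) = A +> (x \<otimes> r)"
proof -
  interpret I: ideal I R by fact
  interpret N: ideal N R by fact
  interpret A: ideal A R by fact
  have xc: "x \<in> carrier R" using x by simp
  have key: "A +> (y \<otimes> s) = A +> (x \<otimes> r)" if s: "s \<in> I +> r" and y: "y \<in> A +> x" for s y
  proof -
    obtain i where i: "i \<in> I" "s = i \<oplus> r" using coset_rep[OF s] by metis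
    obtain a where a: "a \<in> A" "y = a \<oplus> x" using coset_rep[OF y] by metis
    have c: "i \<in> carrier R" "a \<in> carrier R" using i a by auto
    have yN: "a \<oplus> x \<in> N" using a x AN by blast
    have "(a \<oplus> x) \<otimes> i \<in> A" using ideal_prod.prod[OF yN i(1), of R] NI by blast
    moreover have "a \<otimes> r \<in> A" using a r by (simp add: A.I_r_closed)
    ultimately have "(a \<oplus> x) \<otimes> i \<oplus> a \<otimes> r \<in> A" by simp
    moreover have "y \<otimes> s = ((a \<oplus> x) \<otimes> i \<oplus> a \<otimes> r) \<oplus> x \<otimes> r"
      using c r xc i a by (simp add: l_distr r_distr a_ac)
    ultimately show ?thesis using coset_absorb[OF A] r xc by simp
  qed
  have "r \<in> I +> r" "x \<in> A +> x" using r xc by (auto intro: I.a_rcos_self A.a_rcos_self)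
  then have "I +> r \<noteq> {}" "A +> x \<noteq> {}" by blast+
  moreover have "rcoset_mult R A (A +> x) (I +> r) = (\<Union>s\<in>A +> x. \<Union>y\<in>I +> r. A +> (x \<otimes> r))"
    unfolding rcoset_mult_def using key by (intro SUP_cong refl)
  ultimately show ?thesis by (simp add: right_quotient_def)
qed

lemma quotient_abelian_group:
  assumes N: "ideal N R" and A: "ideal A R" and AN: "A \<subseteq> N"
    and M: "carrier M = (\<lambda>x. A +> x) ` N" "add M = set_add R" "zero M = A"
  shows "abelian_group M"
proof -
  interpret N: ideal N R by fact
  interpret A: ideal A R by fact
  have A0: "A +> \<zero> = A" by (rule a_coset_add_zero[OF A.a_subset])
  have add: "(A +> x) <+> (A +> y) = A +> (x \<oplus> y)" if "x \<in> N" "y \<in> N" for x y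
    using that by (simp add: A.a_rcos_sum)
  show ?thesis
  proof (rule abelian_groupI)
    show "\<zero>\<^bsub>M\<^esub> \<in> carrier M"
      unfolding M using A0 N.zero_closed by (metis image_eqI)
  next
    fix Z assume "Z \<in> carrier M"
    then obtain x where x: "x \<in> N" "Z = A +> x" by (auto simp: M)
    show "\<zero>\<^bsub>M\<^esub> \<oplus>\<^bsub>M\<^esub> Z = Z"
      unfolding M x using add[of \<zero> x] x A0 by simp
    have "\<ominus> x \<in> N" using x by simp
    moreover have "(A +> \<ominus> x) <+> (A +> x) = A" using add[of "\<ominus> x" x] x A0 by (simp add: l_neg)
    ultimately show "\<exists>Y\<in>carrier M. Y \<oplus>\<^bsub>M\<^esub> Z = \<zero>\<^bsub>M\<^esub>" unfolding M x by blast
  qed (auto simp: M add a_ac)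
qed

lemma left_quotient_module:
  assumes "ideal I R" "ideal N R" "ideal A R" "A \<subseteq> N" "I \<cdot> N \<subseteq> A"
  shows "left_module (R Quot I) (left_quotient R N A)"
proof -
  interpret I: ideal I R by fact
  interpret N: ideal N R by fact
  interpret A: ideal A R by fact
  have C: "Z \<in> carrier (R Quot I) \<longleftrightarrow> (\<exists>r\<in>carrier R. Z = I +> r)" for Z
    by (auto simp: FactRing_def A_RCOSETS_def')
  have D: "Z \<in> carrier (left_quotient R N A) \<longleftrightarrow> (\<exists>x\<in>N. Z = A +> x)" for Z
    by (auto simp: left_quotient_def)
  have addQ: "(I +> r) \<oplus>\<^bsub>R Quot I\<^esub> (I +> s) = I +> (r \<oplus> s)" if "r \<in> carrier R" "s \<in> carrier R" for r s
    using that by (simp add: FactRing_def I.a_rcos_sum)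
  have multQ: "(I +> r) \<otimes>\<^bsub>R Quot I\<^esub> (I +> s) = I +> (r \<otimes> s)" if "r \<in> carrier R" "s \<in> carrier R" for r s
    using that by (simp add: FactRing_def I.rcoset_mult_add)
  have oneQ: "\<one>\<^bsub>R Quot I\<^esub> = I +> \<one>" by (simp add: FactRing_def)
  have addM: "(A +> x) \<oplus>\<^bsub>left_quotient R N A\<^esub> (A +> y) = A +> (x \<oplus> y)" if "x \<in> N" "y \<in> N" for x y
    using that by (simp add: left_quotient_def A.a_rcos_sum)
  note sm = left_quotient_smult[OF assms]
  have closed: "r \<otimes> x \<in> N" if "r \<in> carrier R" "x \<in> N" for r x
    using that by (simp add: N.I_l_closed)
  show ?thesis
  proof (intro left_module.intro left_module_axioms.intro)
    show "ring (R Quot I)" by (rule I.quotient_is_ring)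
    show "abelian_group (left_quotient R N A)"
      by (rule quotient_abelian_group[OF assms(2-4)]) (simp_all add: left_quotient_def)
  qed (auto simp: C D addQ multQ oneQ addM sm closed l_distr r_distr m_assoc)
qed

lemma right_quotient_module:
  assumes "ideal I R" "ideal N R" "ideal A R" "A \<subseteq> N" "N \<cdot> I \<subseteq> A"
  shows "right_module (R Quot I) (right_quotient R N A)"
proof -
  interpret I: ideal I R by fact
  interpret N: ideal N R by fact
  interpret A: ideal A R by fact
  have C: "Z \<in> carrier (R Quot I) \<longleftrightarrow> (\<exists>r\<in>carrier R. Z = I +> r)" for Z
    by (auto simp: FactRing_def A_RCOSETS_def')
  have D: "Z \<in> carrier (right_quotient R N A) \<longleftrightarrow> (\<exists>x\<in>N. Z = A +> x)" for Z
    by (auto simp: right_quotient_def)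
  have addQ: "(I +> r) \<oplus>\<^bsub>R Quot I\<^esub> (I +> s) = I +> (r \<oplus> s)" if "r \<in> carrier R" "s \<in> carrier R" for r s
    using that by (simp add: FactRing_def I.a_rcos_sum)
  have multQ: "(I +> r) \<otimes>\<^bsub>R Quot I\<^esub> (I +> s) = I +> (r \<otimes> s)" if "r \<in> carrier R" "s \<in> carrier R" for r s
    using that by (simp add: FactRing_def I.rcoset_mult_add)
  have oneQ: "\<one>\<^bsub>R Quot I\<^esub> = I +> \<one>" by (simp add: FactRing_def)
  have addM: "(A +> x) \<oplus>\<^bsub>right_quotient R N A\<^esub> (A +> y) = A +> (x \<oplus> y)" if "x \<in> N" "y \<in> N" for x y
    using that by (simp add: right_quotient_def A.a_rcos_sum)
  note sm = right_quotient_smult[OF assms]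
  have closed: "x \<otimes> r \<in> N" if "r \<in> carrier R" "x \<in> N" for r x
    using that by (simp add: N.I_r_closed)
  show ?thesis
  proof (intro right_module.intro right_module_axioms.intro)
    show "ring (R Quot I)" by (rule I.quotient_is_ring)
    show "abelian_group (right_quotient R N A)"
      by (rule quotient_abelian_group[OF assms(2-4)]) (simp_all add: right_quotient_def)
  qed (auto simp: C D addQ multQ oneQ addM sm closed l_distr r_distr m_assoc)
qed

lemma ideal_prod_mono:
  assumes "I \<subseteq> I'" "J \<subseteq> J'"
  shows "I \<cdot> J \<subseteq> I' \<cdot> J'"
proof
  fix s assume "s \<in> I \<cdot> J"
  then show "s \<in> I' \<cdot> J'"
    by (induction rule: ideal_prod.induct) (use assms in \<open>auto intro: ideal_prod.intros\<close>)
qed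

text \<open>The hypotheses on \<open>A\<close> in \<^const>\<open>link\<close> make \<open>(Q \<inter> P)/A\<close> a module on both sides.\<close>

lemma link_modules:
  assumes "ideal Q R" "ideal P R" "ideal A R" "Q \<cdot> P \<subseteq> A" "A \<subset> Q \<inter> P"
  shows "left_module (R Quot Q) (left_quotient R (Q \<inter> P) A)"
    and "right_module (R Quot P) (right_quotient R (Q \<inter> P) A)"
proof -
  have N: "ideal (Q \<inter> P) R" by (rule i_intersect[OF assms(1,2)])
  show "left_module (R Quot Q) (left_quotient R (Q \<inter> P) A)"
    using ideal_prod_mono[of Q Q "Q \<inter> P" P] assms
    by (intro left_quotient_module N) auto
  show "right_module (R Quot P) (right_quotient R (Q \<inter> P) A)"
    using ideal_prod_mono[of "Q \<inter> P" Q P P] assms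
    by (intro right_quotient_module N) auto
qed

end

end

theory Submission
  imports Defs
begin

text \<open>
  The ideals \<open>\<sigma>\<^sup>i(Q)\<close> are finitely many, and distinct ones are incomparable, so \<open>Q\<^sup>0 = Q \<inter> D\<close> where the
  intersection \<open>D\<close> of the conjugates other than \<open>Q\<close> is not contained in the prime \<open>Q\<close>
  (\<open>invariant_part_split\<close>); likewise \<open>P\<^sup>0 = P \<inter> E\<close> with \<open>E\<close> not contained in \<open>P\<close>. For
  any such ideals \<open>D\<close> and \<open>E\<close>, if \<open>A\<close> realizes a link
  \<open>Q \<rightarrow> P\<close>, then \<open>A \<inter> Q\<^sup>0 \<inter> P\<^sup>0\<close> realizes a link \<open>Q\<^sup>0 \<rightarrow> P\<^sup>0\<close> (\<open>link_intersect\<close>).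

  For torsionfreeness, \<open>(Q\<^sup>0 \<inter> P\<^sup>0)/(A \<inter> Q\<^sup>0 \<inter> P\<^sup>0)\<close> embeds in \<open>(Q \<inter> P)/A\<close>, and an element regular modulo
  \<open>Q\<^sup>0\<close> is regular modulo its minimal prime \<open>Q\<close> (\<open>regular_modulo_component\<close>). The point is that the
  new quotient is not zero. The ideals \<open>D\<close> and \<open>E\<close> contain elements \<open>d\<close> and \<open>e\<close> regular modulo \<open>Q\<close> and
  \<open>P\<close> respectively, and \<open>d (Q \<inter> P) e \<subseteq> Q\<^sup>0 \<inter> P\<^sup>0\<close>; if this were contained in \<open>A\<close>, then cancelling \<open>d\<close> on
  the left and \<open>e\<close> on the right would give \<open>Q \<inter> P \<subseteq> A\<close>.

  The existence of \<open>d\<close> and \<open>e\<close> is the part of Goldie's theorem saying that a nonzero ideal of a prime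
  noetherian ring contains a regular element (\<open>regular_in_ideal\<close>). It is proved by computing in \<open>R\<close>
  modulo the prime ideal, with chain conditions applied to annihilators: an element of the ideal whose
  right annihilator is stable under squaring and as small as possible has zero right annihilator
  (\<open>right_regular_in_ideal\<close>), and right regular elements are left regular
  (\<open>right_regular_imp_regular\<close>).
\<close>

section \<open>Prime ideals and noetherian conditions\<close>

lemma (in ring) ideal_prod_subset:
  assumes "ideal P R" "\<And>i j. i \<in> I \<Longrightarrow> j \<in> J \<Longrightarrow> i \<otimes> j \<in> P"
  shows "I \<cdot> J \<subseteq> P"
proof
  interpret P: ideal P R by fact
  fix s assume "s \<in> I \<cdot> J"
  then show "s \<in> P"
    by (induction rule: ideal_prod.induct) (use assms in auto)
qed

text \<open>
  The elements \<open>y\<close> with \<open>a R y \<subseteq> P\<close> form an ideal \<open>B\<close>, and the elements \<open>x\<close> with \<open>x B \<subseteq> P\<close> form an ideal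
  \<open>A\<close>. These contain \<open>b\<close> and \<open>a\<close>, which spares a description of the ideals that \<open>a\<close> and \<open>b\<close> generate.
\<close>

lemma (in ring) prime_ideal_elements:
  assumes P: "prime_ideal P R" and a: "a \<in> carrier R" and b: "b \<in> carrier R"
    and ab: "\<And>r. r \<in> carrier R \<Longrightarrow> a \<otimes> r \<otimes> b \<in> P"
  shows "a \<in> P \<or> b \<in> P"
proof -
  interpret P: ideal P R using P by (simp add: prime_ideal_def)
  define B where "B = {y \<in> carrier R. \<forall>r\<in>carrier R. a \<otimes> r \<otimes> y \<in> P}"
  define A where "A = {x \<in> carrier R. \<forall>y\<in>B. x \<otimes> y \<in> P}"
  have B: "ideal B R"
  proof (rule idealI[OF ring_axioms])
    show "subgroup B (add_monoid R)"
      by (rule add.subgroupI) (use a in \<open>auto simp: B_def r_distr r_minus\<close>)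
    fix y r assume yr: "y \<in> B" "r \<in> carrier R"
    have "a \<otimes> s \<otimes> (r \<otimes> y) = a \<otimes> (s \<otimes> r) \<otimes> y" "a \<otimes> s \<otimes> (y \<otimes> r) = a \<otimes> s \<otimes> y \<otimes> r"
      if "s \<in> carrier R" for s
      using that a yr by (simp_all add: B_def m_assoc)
    then show "r \<otimes> y \<in> B" "y \<otimes> r \<in> B" using yr by (auto simp: B_def P.I_r_closed)
  qed
  interpret B: ideal B R by (rule B)
  have A: "ideal A R"
  proof (rule idealI[OF ring_axioms])
    show "subgroup A (add_monoid R)"
      by (rule add.subgroupI) (auto simp: A_def l_distr l_minus)
    fix x r assume xr: "x \<in> A" "r \<in> carrier R"
    then show "r \<otimes> x \<in> A" "x \<otimes> r \<in> A"
      by (auto simp: A_def m_assoc P.I_l_closed B.I_l_closed)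
  qed
  have "A \<cdot> B \<subseteq> P" by (rule ideal_prod_subset[OF P.ideal_axioms]) (simp add: A_def)
  then have "A \<subseteq> P \<or> B \<subseteq> P" using P A B by (auto simp: prime_ideal_def)
  moreover have "b \<in> B" unfolding B_def using b ab by blast
  moreover have "a \<in> A"
  proof -
    have "a \<otimes> y \<in> P" if "y \<in> B" for y
    proof -
      have "a \<otimes> \<one> \<otimes> y \<in> P" using that one_closed unfolding B_def by blast
      then show ?thesis using a by simp
    qed
    then show ?thesis using a by (simp add: A_def)
  qed
  ultimately show ?thesis by blast
qed

text \<open>
  The family is indexed because the maximal member will be the annihilator of some element, and it is
  that element which is wanted.
\<close>

lemma acc_maximal:
  fixes F :: "'i \<Rightarrow> 'a set"
  assumes acc: "\<And>C :: nat \<Rightarrow> 'a set. (\<And>n. p (C n)) \<Longrightarrow> (\<And>n. C n \<subseteq> C (Suc n)) \<Longrightarrow> \<exists>N. \<forall>n\<ge>N. C n = C N"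
    and F: "\<And>i. i \<in> X \<Longrightarrow> p (F i)" and X: "X \<noteq> {}"
  obtains i where "i \<in> X" "\<And>j. j \<in> X \<Longrightarrow> F i \<subseteq> F j \<Longrightarrow> F j = F i"
proof (rule ccontr)
  assume no: "\<not> thesis"
  note max = that
  have step: "\<exists>j. j \<in> X \<and> F i \<subset> F j" if i: "i \<in> X" for i
  proof (rule ccontr)
    assume "\<nexists>j. j \<in> X \<and> F i \<subset> F j"
    then have "F j = F i" if "j \<in> X" "F i \<subseteq> F j" for j using that by blast
    then show False using max[OF i] no by blast
  qed
  obtain i0 where i0: "i0 \<in> X" using X by blast
  define g where "g i = (SOME j. j \<in> X \<and> F i \<subset> F j)" for i
  have g: "g i \<in> X \<and> F i \<subset> F (g i)" if "i \<in> X" for i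
    unfolding g_def by (rule someI_ex[OF step[OF that]])
  define f where "f n = (g ^^ n) i0" for n
  have f1: "f n \<in> X" for n by (induction n) (simp_all add: f_def i0 g)
  then have f: "f n \<in> X" "F (f n) \<subset> F (f (Suc n))" for n
    using g[OF f1[of n]] by (simp_all add: f_def)
  obtain N where N: "\<forall>n\<ge>N. F (f n) = F (f N)"
    using acc[of "\<lambda>n. F (f n)", OF F[OF f(1)] psubset_imp_subset[OF f(2)]] by blast
  have "F (f (Suc N)) = F (f N)" by (rule N[rule_format]) simp
  then show False using f(2)[of N] by simp
qed

lemma right_noetherian_maximal:
  fixes F :: "'i \<Rightarrow> 'a set"
  assumes "right_noetherian R" "\<And>i. i \<in> X \<Longrightarrow> right_ideal (F i) R" "X \<noteq> {}"
  obtains i where "i \<in> X" "\<And>j. j \<in> X \<Longrightarrow> F i \<subseteq> F j \<Longrightarrow> F j = F i"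
proof -
  have acc: "\<exists>N. \<forall>n\<ge>N. C n = C N" if "\<And>n. right_ideal (C n) R" "\<And>n. C n \<subseteq> C (Suc n)" for C
    using assms(1) that unfolding right_noetherian_def by blast
  show thesis
    by (rule acc_maximal[of "\<lambda>I. right_ideal I R" X F, OF acc assms(2,3) that])
qed

lemma left_noetherian_maximal:
  fixes F :: "'i \<Rightarrow> 'a set"
  assumes "left_noetherian R" "\<And>i. i \<in> X \<Longrightarrow> left_ideal (F i) R" "X \<noteq> {}"
  obtains i where "i \<in> X" "\<And>j. j \<in> X \<Longrightarrow> F i \<subseteq> F j \<Longrightarrow> F j = F i"
proof -
  have acc: "\<exists>N. \<forall>n\<ge>N. C n = C N" if "\<And>n. left_ideal (C n) R" "\<And>n. C n \<subseteq> C (Suc n)" for C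
    using assms(1) that unfolding left_noetherian_def by blast
  show thesis
    by (rule acc_maximal[of "\<lambda>I. left_ideal I R" X F, OF acc assms(2,3) that])
qed


section \<open>Regular elements modulo a prime ideal\<close>

definition regular_modulo :: "('a, 'b) ring_scheme \<Rightarrow> 'a set \<Rightarrow> 'a \<Rightarrow> bool" where
  "regular_modulo R I c \<longleftrightarrow> c \<in> carrier R \<and>
     (\<forall>x\<in>carrier R. c \<otimes>\<^bsub>R\<^esub> x \<in> I \<longrightarrow> x \<in> I) \<and> (\<forall>x\<in>carrier R. x \<otimes>\<^bsub>R\<^esub> c \<in> I \<longrightarrow> x \<in> I)"

text \<open>
  Write \<open>r(b)\<close> for the set of all \<open>x\<close> with \<open>b x \<in> P\<close>. If \<open>r(b)\<close> is maximal among the left multiples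
  \<open>b = t a\<close> outside \<open>P\<close>, then every left multiple \<open>b s b\<close> of \<open>b\<close> that is outside \<open>P\<close> has the same
  annihilator as \<open>b\<close>, and one exists because \<open>P\<close> is prime. This replaces the usual argument that nil
  one-sided ideals of the quotient vanish.
\<close>

lemma (in ring) ex_left_multiple_stable_annihilator:
  assumes noeth: "right_noetherian R" and P: "prime_ideal P R"
    and a: "a \<in> carrier R" "a \<notin> P"
  obtains s t where "s \<in> carrier R" "t \<in> carrier R" "t \<otimes> a \<otimes> s \<otimes> (t \<otimes> a) \<notin> P"
    "\<And>x. x \<in> carrier R \<Longrightarrow> t \<otimes> a \<otimes> s \<otimes> (t \<otimes> a) \<otimes> x \<in> P \<Longrightarrow> t \<otimes> a \<otimes> x \<in> P"
proof -
  interpret P: ideal P R using P by (simp add: prime_ideal_def)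
  define X where "X = {t \<in> carrier R. t \<otimes> a \<notin> P}"
  define F where "F t = {x \<in> carrier R. t \<otimes> a \<otimes> x \<in> P}" for t
  have "right_ideal (F t) R" if "t \<in> X" for t
    unfolding right_ideal_def
  proof (intro conjI ballI)
    have ta: "t \<otimes> a \<in> carrier R" using that a by (simp add: X_def)
    show "additive_subgroup (F t) R"
      by (intro additive_subgroup.intro add.subgroupI) (use ta in \<open>auto simp: F_def r_distr r_minus\<close>)
    fix r x assume "r \<in> carrier R" "x \<in> F t"
    then show "x \<otimes> r \<in> F t" using ta by (auto simp: F_def m_assoc[symmetric] P.I_r_closed)
  qed
  moreover have "\<one> \<in> X" using a by (simp add: X_def)
  ultimately obtain t where t: "t \<in> X" and max: "\<And>u. u \<in> X \<Longrightarrow> F t \<subseteq> F u \<Longrightarrow> F u = F t"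
    using right_noetherian_maximal[OF noeth, of X F] by (metis empty_iff)
  define b where "b = t \<otimes> a"
  have tc: "t \<in> carrier R" and b: "b \<in> carrier R" "b \<notin> P" using t a by (simp_all add: X_def b_def)
  obtain s where s: "s \<in> carrier R" "b \<otimes> s \<otimes> b \<notin> P"
    using prime_ideal_elements[OF P b(1) b(1)] b(2) by blast
  have eq: "b \<otimes> s \<otimes> t \<otimes> a = b \<otimes> s \<otimes> b" using s b tc a by (simp add: b_def m_assoc)
  have u: "b \<otimes> s \<otimes> t \<in> X" using eq s b tc by (simp add: X_def)
  have "F t \<subseteq> F (b \<otimes> s \<otimes> t)"
  proof
    fix x assume x: "x \<in> F t"
    then have "b \<otimes> s \<otimes> (b \<otimes> x) \<in> P" using b s by (simp add: F_def b_def P.I_l_closed)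
    then show "x \<in> F (b \<otimes> s \<otimes> t)" using x b s by (simp add: F_def eq m_assoc)
  qed
  then have "F (b \<otimes> s \<otimes> t) = F t" by (rule max[OF u])
  then have "b \<otimes> x \<in> P" if "x \<in> carrier R" "b \<otimes> s \<otimes> b \<otimes> x \<in> P" for x
    using that by (auto simp: F_def eq b_def[symmetric])
  then show thesis using that[of s t] s tc by (simp add: b_def)
qed

text \<open>
  With \<open>b = t a\<close> as above, \<open>w = a s b s t\<close> works: since \<open>t a = b\<close>, the condition \<open>w w x \<in> P\<close>,
  multiplied by \<open>t\<close> from the left, reads \<open>b s b s b s b s t x \<in> P\<close>, and factors \<open>b s\<close> can be stripped
  until \<open>b s t x \<in> P\<close> remains.
\<close>

lemma (in ring) ex_right_multiple_stable_annihilator: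
  assumes noeth: "right_noetherian R" and P: "prime_ideal P R"
    and a: "a \<in> carrier R" "a \<notin> P"
  obtains z where "z \<in> carrier R" "a \<otimes> z \<notin> P"
    "\<And>x. x \<in> carrier R \<Longrightarrow> a \<otimes> z \<otimes> (a \<otimes> z) \<otimes> x \<in> P \<Longrightarrow> a \<otimes> z \<otimes> x \<in> P"
proof -
  interpret P: ideal P R using P by (simp add: prime_ideal_def)
  obtain s t where st: "s \<in> carrier R" "t \<in> carrier R" and nP: "t \<otimes> a \<otimes> s \<otimes> (t \<otimes> a) \<notin> P"
    and strip: "\<And>x. x \<in> carrier R \<Longrightarrow> t \<otimes> a \<otimes> s \<otimes> (t \<otimes> a) \<otimes> x \<in> P \<Longrightarrow> t \<otimes> a \<otimes> x \<in> P"
    using ex_left_multiple_stable_annihilator[OF assms] by metis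
  define b where "b = t \<otimes> a"
  have b: "b \<in> carrier R" using st a by (simp add: b_def)
  define z where "z = s \<otimes> b \<otimes> s \<otimes> t"
  have z: "z \<in> carrier R" using st b by (simp add: z_def)
  have bb: "b \<otimes> x \<in> P" if "x \<in> carrier R" "b \<otimes> (s \<otimes> (b \<otimes> x)) \<in> P" for x
    using strip[of x] that st b by (simp add: b_def[symmetric] m_assoc)
  have ta: "t \<otimes> (a \<otimes> x) = b \<otimes> x" if "x \<in> carrier R" for x
    using that st a by (simp add: b_def m_assoc)
  show thesis
  proof (rule that[OF z])
    show "a \<otimes> z \<notin> P"
    proof
      assume "a \<otimes> z \<in> P"
      then have "t \<otimes> (a \<otimes> z) \<otimes> a \<in> P" using st a by (simp add: P.I_l_closed P.I_r_closed)
      moreover have "t \<otimes> (a \<otimes> z) \<otimes> a = b \<otimes> (s \<otimes> (b \<otimes> (s \<otimes> b)))"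
        using z st a b by (simp add: ta) (simp add: z_def m_assoc b_def)
      ultimately have "b \<otimes> (s \<otimes> b) \<in> P" using bb[of "s \<otimes> b"] st b by simp
      then show False using nP st b by (simp add: b_def[symmetric] m_assoc)
    qed
    fix x assume x: "x \<in> carrier R" and "a \<otimes> z \<otimes> (a \<otimes> z) \<otimes> x \<in> P"
    then have "t \<otimes> (a \<otimes> z \<otimes> (a \<otimes> z) \<otimes> x) \<in> P" using st by (simp add: P.I_l_closed)
    moreover have "t \<otimes> (a \<otimes> z \<otimes> (a \<otimes> z) \<otimes> x)
        = b \<otimes> (s \<otimes> (b \<otimes> (s \<otimes> (b \<otimes> (s \<otimes> (b \<otimes> (s \<otimes> (t \<otimes> x))))))))"
      using z st a b x by (simp add: ta m_assoc) (simp add: z_def m_assoc ta)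
    ultimately have "b \<otimes> (s \<otimes> (b \<otimes> (s \<otimes> (b \<otimes> (s \<otimes> (t \<otimes> x)))))) \<in> P"
      using bb[of "s \<otimes> (b \<otimes> (s \<otimes> (b \<otimes> (s \<otimes> (t \<otimes> x)))))"] st b x by simp
    then have "b \<otimes> (s \<otimes> (b \<otimes> (s \<otimes> (t \<otimes> x)))) \<in> P"
      using bb[of "s \<otimes> (b \<otimes> (s \<otimes> (t \<otimes> x)))"] st b x by simp
    then have "b \<otimes> (s \<otimes> (t \<otimes> x)) \<in> P"
      using bb[of "s \<otimes> (t \<otimes> x)"] st b x by simp
    then have "a \<otimes> s \<otimes> (b \<otimes> (s \<otimes> (t \<otimes> x))) \<in> P" using a st by (simp add: P.I_l_closed)
    then show "a \<otimes> z \<otimes> x \<in> P" using a st b x by (simp add: z_def m_assoc)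
  qed
qed

text \<open>
  With \<open>r(c)\<close> as above, consider the \<open>c \<in> E\<close> with \<open>r(c c) = r(c)\<close>. If \<open>c w \<in> P\<close> and both \<open>c\<close> and \<open>w\<close> are of
  this kind, then so is \<open>c + w\<close>, and \<open>r(c + w) = r(c) \<inter> r(w)\<close>; this is a proper subset of \<open>r(c)\<close> if
  \<open>w \<notin> P\<close>, as then \<open>w w \<notin> P\<close>. So \<open>r(c) = P\<close> as soon as \<open>r(c)\<close> is minimal. Minimal right annihilators
  exist because their left annihilators \<open>L c\<close> satisfy the ascending chain condition.
\<close>

lemma (in ring) right_regular_in_ideal:
  assumes noeth: "noetherian R" and P: "prime_ideal P R"
    and E: "ideal E R" "\<not> E \<subseteq> P"
  obtains c where "c \<in> E" "\<And>x. x \<in> carrier R \<Longrightarrow> c \<otimes> x \<in> P \<Longrightarrow> x \<in> P"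
proof -
  interpret P: ideal P R using P by (simp add: prime_ideal_def)
  interpret E: ideal E R by fact
  define X where "X = {c \<in> E. \<forall>x\<in>carrier R. c \<otimes> c \<otimes> x \<in> P \<longrightarrow> c \<otimes> x \<in> P}"
  define L where "L c = {y \<in> carrier R. \<forall>x\<in>carrier R. c \<otimes> x \<in> P \<longrightarrow> y \<otimes> x \<in> P}" for c
  have L: "left_ideal (L c) R" if "c \<in> X" for c
    unfolding left_ideal_def
  proof (intro conjI ballI)
    show "additive_subgroup (L c) R"
      by (intro additive_subgroup.intro add.subgroupI) (auto simp: L_def l_distr l_minus)
    fix r x assume "r \<in> carrier R" "x \<in> L c"
    then show "r \<otimes> x \<in> L c" by (auto simp: L_def m_assoc P.I_l_closed)
  qed
  have "\<zero> \<in> X" by (simp add: X_def)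
  then obtain c where c: "c \<in> X" and max: "\<And>c'. c' \<in> X \<Longrightarrow> L c \<subseteq> L c' \<Longrightarrow> L c' = L c"
    using left_noetherian_maximal[of R X L] L noeth by (metis empty_iff noetherian_def)
  have cE: "c \<in> E" and cc: "\<And>x. x \<in> carrier R \<Longrightarrow> c \<otimes> c \<otimes> x \<in> P \<Longrightarrow> c \<otimes> x \<in> P"
    using c by (auto simp: X_def)
  have cR: "c \<in> carrier R" using cE by simp
  have "k \<in> P" if k: "k \<in> carrier R" "c \<otimes> k \<in> P" for k
  proof (rule ccontr)
    assume kP: "k \<notin> P"
    \<comment> \<open>The annihilator of \<open>c\<close> is moved into \<open>E\<close>, so that \<open>c + w\<close> stays in \<open>E\<close>.\<close>
    obtain e where e: "e \<in> E" "e \<notin> P" using E(2) by blast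
    obtain r where r: "r \<in> carrier R" "k \<otimes> r \<otimes> e \<notin> P"
      using prime_ideal_elements[OF P, of k e] k(1) e kP by auto
    define a where "a = k \<otimes> r \<otimes> e"
    have a: "a \<in> carrier R" "a \<notin> P" "a \<in> E"
      using k r e by (simp_all add: a_def E.I_l_closed)
    obtain z where z: "z \<in> carrier R" and azP: "a \<otimes> z \<notin> P"
      and sq: "\<And>x. x \<in> carrier R \<Longrightarrow> a \<otimes> z \<otimes> (a \<otimes> z) \<otimes> x \<in> P \<Longrightarrow> a \<otimes> z \<otimes> x \<in> P"
      using ex_right_multiple_stable_annihilator[OF _ P a(1,2)] noeth
      by (metis noetherian_def)
    define w where "w = a \<otimes> z"
    have w: "w \<in> E" "w \<in> carrier R" "w \<notin> P"
      using a z azP by (simp_all add: w_def E.I_r_closed)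
    have ww: "w \<otimes> x \<in> P" if "x \<in> carrier R" "w \<otimes> (w \<otimes> x) \<in> P" for x
      using sq[of x] that w(2) by (simp add: w_def[symmetric] m_assoc)
    have "c \<otimes> w = c \<otimes> k \<otimes> (r \<otimes> e \<otimes> z)" using cR k r e z by (simp add: w_def a_def m_assoc)
    then have cw: "c \<otimes> w \<in> P" using k r e z by (simp add: P.I_r_closed)
    have cwx: "c \<otimes> (w \<otimes> x) \<in> P" if "x \<in> carrier R" for x
      using P.I_r_closed[OF cw that] cR w that by (simp add: m_assoc)
    have cancel: "y \<in> P" if "x \<in> P" "x \<oplus> y \<in> P" "y \<in> carrier R" for x y
    proof -
      have "y = \<ominus> x \<oplus> (x \<oplus> y)" using that by (simp add: r_neg1)
      then show ?thesis using that P.a_closed P.a_inv_closed by metis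
    qed
    have split: "c \<otimes> x \<in> P \<and> w \<otimes> x \<in> P" if x: "x \<in> carrier R" "c \<otimes> x \<oplus> w \<otimes> x \<in> P" for x
    proof -
      have *: "c \<otimes> (w \<otimes> x) \<oplus> c \<otimes> (c \<otimes> x) \<in> P"
        using P.I_l_closed[OF x(2) cR] x cR w by (simp add: r_distr a_comm)
      have "c \<otimes> (c \<otimes> x) \<in> P" using cancel[OF cwx *] x cR w by simp
      then have "c \<otimes> x \<in> P" using cc[of x] x cR by (simp add: m_assoc)
      then show ?thesis using cancel[OF _ x(2)] x cR w by simp
    qed
    have "c \<oplus> w \<in> X"
      unfolding X_def
    proof (intro CollectI conjI ballI impI)
      show "c \<oplus> w \<in> E" using cE w by simp
      fix x assume x: "x \<in> carrier R" and "(c \<oplus> w) \<otimes> (c \<oplus> w) \<otimes> x \<in> P"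
      moreover have "(c \<oplus> w) \<otimes> (c \<oplus> w) \<otimes> x
          = c \<otimes> (c \<otimes> x \<oplus> w \<otimes> x) \<oplus> w \<otimes> (c \<otimes> x \<oplus> w \<otimes> x)"
        using x cR w(2) by (simp add: m_assoc l_distr)
      ultimately have "c \<otimes> (c \<otimes> x \<oplus> w \<otimes> x) \<oplus> w \<otimes> (c \<otimes> x \<oplus> w \<otimes> x) \<in> P" by metis
      moreover have "c \<otimes> x \<oplus> w \<otimes> x \<in> carrier R" using x cR w(2) by simp
      ultimately have "c \<otimes> (c \<otimes> x \<oplus> w \<otimes> x) \<in> P" "w \<otimes> (c \<otimes> x \<oplus> w \<otimes> x) \<in> P"
        using split by blast+
      then have *: "c \<otimes> (w \<otimes> x) \<oplus> c \<otimes> (c \<otimes> x) \<in> P" "w \<otimes> (c \<otimes> x) \<oplus> w \<otimes> (w \<otimes> x) \<in> P"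
        using x cR w by (simp_all add: r_distr a_comm)
      have "c \<otimes> (c \<otimes> x) \<in> P" using cancel[OF cwx *(1)] x cR w by simp
      then have 1: "c \<otimes> x \<in> P" using cc[of x] x cR by (simp add: m_assoc)
      then have "w \<otimes> (w \<otimes> x) \<in> P"
        using cancel[OF P.I_l_closed[OF 1 w(2)] *(2)] x w by simp
      then have "w \<otimes> x \<in> P" by (rule ww[OF x])
      then show "(c \<oplus> w) \<otimes> x \<in> P" using 1 x cR w by (simp add: l_distr)
    qed
    moreover have ann: "c \<otimes> x \<in> P \<and> w \<otimes> x \<in> P" if "x \<in> carrier R" "(c \<oplus> w) \<otimes> x \<in> P" for x
      using split[OF that(1)] that cR w(2) by (simp add: l_distr)
    then have "L c \<subseteq> L (c \<oplus> w)" unfolding L_def by blast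
    ultimately have "L (c \<oplus> w) = L c" by (rule max)
    moreover have "w \<in> L (c \<oplus> w)" using ann w(2) unfolding L_def by blast
    ultimately have "w \<in> L c" by simp
    then have "w \<otimes> w \<in> P" using cw w(2) unfolding L_def by blast
    then show False using ww[of \<one>] w by simp
  qed
  then show thesis using that cE by blast
qed

text \<open>
  Suppose \<open>a c \<in> P\<close> and \<open>a \<notin> P\<close>, and let \<open>d = s (t a)\<close> be as in \<open>ex_left_multiple_stable_annihilator\<close>.
  Since, modulo \<open>P\<close>, \<open>t a\<close> kills \<open>c R\<close> but acts injectively on \<open>d R\<close>, the right ideals
  \<open>d R\<close> and \<open>c R\<close> are independent modulo \<open>P\<close>. As \<open>c\<close> is right regular, \<open>d R\<close>, \<open>c d R\<close>, \<open>c c d R\<close>, \<open>\<dots>\<close>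
  are then independent too, and the right ideals \<open>C n = P + d R + \<dots> + c\<^sup>n\<^sup>-\<^sup>1 d R\<close> increase strictly.
\<close>

lemma (in ring) right_regular_imp_regular:
  assumes noeth: "right_noetherian R" and P: "prime_ideal P R"
    and c: "c \<in> carrier R" and reg: "\<And>x. x \<in> carrier R \<Longrightarrow> c \<otimes> x \<in> P \<Longrightarrow> x \<in> P"
  shows "regular_modulo R P c"
proof -
  interpret P: ideal P R using P by (simp add: prime_ideal_def)
  have "a \<in> P" if a: "a \<in> carrier R" "a \<otimes> c \<in> P" for a
  proof (rule ccontr)
    assume "a \<notin> P"
    then obtain s t where st: "s \<in> carrier R" "t \<in> carrier R" and nP: "t \<otimes> a \<otimes> s \<otimes> (t \<otimes> a) \<notin> P"
      and strip: "\<And>x. x \<in> carrier R \<Longrightarrow> t \<otimes> a \<otimes> s \<otimes> (t \<otimes> a) \<otimes> x \<in> P \<Longrightarrow> t \<otimes> a \<otimes> x \<in> P"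
      using ex_left_multiple_stable_annihilator[OF noeth P a(1)] by metis
    define d where "d = s \<otimes> (t \<otimes> a)"
    have d: "d \<in> carrier R" using st a by (simp add: d_def)
    have dP: "d \<notin> P" using nP st a by (auto simp: d_def m_assoc P.I_l_closed)
    have disj: "d \<otimes> y \<in> P" if y: "y \<in> carrier R" "v \<in> carrier R" "d \<otimes> y \<oplus> c \<otimes> v \<in> P" for y v
    proof -
      have "t \<otimes> a \<otimes> (d \<otimes> y \<oplus> c \<otimes> v) \<oplus> t \<otimes> (a \<otimes> c) \<otimes> (\<ominus> v) \<in> P"
        using y st a by (simp add: P.I_l_closed P.I_r_closed)
      moreover have "t \<otimes> a \<otimes> (d \<otimes> y \<oplus> c \<otimes> v) \<oplus> t \<otimes> (a \<otimes> c) \<otimes> (\<ominus> v)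
          = t \<otimes> a \<otimes> s \<otimes> (t \<otimes> a) \<otimes> y"
        using y st a c by (simp add: d_def r_distr m_assoc r_minus a_assoc r_neg)
      ultimately have "t \<otimes> a \<otimes> y \<in> P" using strip[OF y(1)] by simp
      then have "s \<otimes> (t \<otimes> a \<otimes> y) \<in> P" using st by (simp add: P.I_l_closed)
      then show ?thesis using st a y by (simp add: d_def m_assoc)
    qed
    define C where "C = rec_nat P
      (\<lambda>_ D. {u. \<exists>y\<in>carrier R. \<exists>w\<in>D. \<exists>q\<in>P. u = d \<otimes> y \<oplus> c \<otimes> w \<oplus> q})"
    have C0: "C 0 = P" by (simp add: C_def)
    have CS: "C (Suc n) = {u. \<exists>y\<in>carrier R. \<exists>w\<in>C n. \<exists>q\<in>P. u = d \<otimes> y \<oplus> c \<otimes> w \<oplus> q}" for n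
      by (simp add: C_def)
    have rC: "right_ideal (C n) R" for n
    proof (induction n)
      case 0
      show ?case by (auto simp: C0 right_ideal_def P.I_r_closed P.additive_subgroup_axioms)
    next
      case (Suc n)
      interpret D: additive_subgroup "C n" R using Suc by (simp add: right_ideal_def)
      have Dr: "w \<otimes> r \<in> C n" if "w \<in> C n" "r \<in> carrier R" for w r
        using Suc that by (simp add: right_ideal_def)
      show ?case
        unfolding right_ideal_def
      proof (intro conjI ballI)
        show "additive_subgroup (C (Suc n)) R"
        proof (intro additive_subgroup.intro add.subgroupI)
          show "C (Suc n) \<subseteq> carrier R" using c d by (auto simp: CS)
          have "\<zero> = d \<otimes> \<zero> \<oplus> c \<otimes> \<zero> \<oplus> \<zero>" using c d by simp
          then show "C (Suc n) \<noteq> {}" unfolding CS using D.zero_closed P.zero_closed zero_closed by blast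
        next
          fix u assume "u \<in> C (Suc n)"
          then obtain y w q where u: "y \<in> carrier R" "w \<in> C n" "q \<in> P" "u = d \<otimes> y \<oplus> c \<otimes> w \<oplus> q"
            by (auto simp: CS)
          then have "\<ominus> u = d \<otimes> (\<ominus> y) \<oplus> c \<otimes> (\<ominus> w) \<oplus> (\<ominus> q)"
            using c d by (simp add: r_minus minus_add)
          moreover have "\<ominus> y \<in> carrier R" "\<ominus> w \<in> C n" "\<ominus> q \<in> P" using u by simp_all
          ultimately show "\<ominus> u \<in> C (Suc n)" unfolding CS by blast
        next
          fix u u' assume "u \<in> C (Suc n)" "u' \<in> C (Suc n)"
          then obtain y w q y' w' q' where
            u: "y \<in> carrier R" "w \<in> C n" "q \<in> P" "u = d \<otimes> y \<oplus> c \<otimes> w \<oplus> q"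
            and u': "y' \<in> carrier R" "w' \<in> C n" "q' \<in> P" "u' = d \<otimes> y' \<oplus> c \<otimes> w' \<oplus> q'"
            by (auto simp: CS)
          have "w \<oplus> w' \<in> C n" using u u' by simp
          moreover have "q \<oplus> q' \<in> P" using u u' by simp
          moreover have "u \<oplus> u' = d \<otimes> (y \<oplus> y') \<oplus> c \<otimes> (w \<oplus> w') \<oplus> (q \<oplus> q')"
            using c d u u' by (simp add: r_distr a_ac)
          ultimately show "u \<oplus> u' \<in> C (Suc n)" unfolding CS using u(1) u'(1) by blast
        qed
        fix r u assume r: "r \<in> carrier R" and "u \<in> C (Suc n)"
        then obtain y w q where u: "y \<in> carrier R" "w \<in> C n" "q \<in> P" "u = d \<otimes> y \<oplus> c \<otimes> w \<oplus> q"
          by (auto simp: CS)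
        have "u \<otimes> r = d \<otimes> (y \<otimes> r) \<oplus> c \<otimes> (w \<otimes> r) \<oplus> q \<otimes> r"
          using c d u r by (simp add: l_distr m_assoc)
        moreover have "w \<otimes> r \<in> C n" "q \<otimes> r \<in> P" using u r Dr by (auto simp: P.I_r_closed)
        ultimately show "u \<otimes> r \<in> C (Suc n)" unfolding CS using u(1) r by blast
      qed
    qed
    have CR: "C n \<subseteq> carrier R" for n
      using rC[of n] additive_subgroup.a_subset unfolding right_ideal_def by blast
    have mono: "C n \<subseteq> C (Suc n)" for n
    proof (induction n)
      case 0
      have "q = d \<otimes> \<zero> \<oplus> c \<otimes> \<zero> \<oplus> q" if "q \<in> P" for q using that c d by simp
      then show ?case unfolding CS C0 using zero_closed P.zero_closed by blast
    next
      case (Suc n)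
      then show ?case unfolding CS[of n] CS[of "Suc n"] by blast
    qed
    have PC: "P \<subseteq> C n" for n
      by (induction n) (use mono C0 in blast)+
    have "\<not> C (Suc n) \<subseteq> C n" for n
    proof (induction n)
      case 0
      have "d = d \<otimes> \<one> \<oplus> c \<otimes> \<zero> \<oplus> \<zero>" using c d by simp
      then have "d \<in> C (Suc 0)" unfolding CS C0 using one_closed P.zero_closed by blast
      then show ?case using dP C0 by blast
    next
      case (Suc n)
      show ?case
      proof
        assume sub: "C (Suc (Suc n)) \<subseteq> C (Suc n)"
        have "z \<in> C n" if z: "z \<in> C (Suc n)" for z
        proof -
          have zR: "z \<in> carrier R" using z CR by blast
          have "c \<otimes> z = d \<otimes> \<zero> \<oplus> c \<otimes> z \<oplus> \<zero>" using c d zR by simp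
          then have "c \<otimes> z \<in> C (Suc (Suc n))"
            unfolding CS[of "Suc n"] using z P.zero_closed zero_closed by blast
          then have "c \<otimes> z \<in> C (Suc n)" using sub by blast
          then obtain y w q where u: "y \<in> carrier R" "w \<in> C n" "q \<in> P" "c \<otimes> z = d \<otimes> y \<oplus> c \<otimes> w \<oplus> q"
            by (auto simp: CS)
          have w: "w \<in> carrier R" using u CR by blast
          have qR: "q \<in> carrier R" using u by simp
          define e where "e = z \<ominus> w"
          have e: "e \<in> carrier R" and ze: "z = w \<oplus> e"
            using w zR by (simp_all add: e_def a_minus_def a_lcomm[of w z] r_neg)
          have "c \<otimes> w \<oplus> c \<otimes> e = c \<otimes> w \<oplus> (d \<otimes> y \<oplus> q)"
            using u(4) c d u(1) w qR e unfolding ze by (simp add: r_distr a_ac)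
          then have ce: "c \<otimes> e = d \<otimes> y \<oplus> q" using c d u(1) w qR e by simp
          have "d \<otimes> y \<oplus> c \<otimes> (\<ominus> e) = \<ominus> q"
            using ce c d u(1) qR e by (simp add: r_minus minus_add r_neg2)
          then have "d \<otimes> y \<in> P" using disj[OF u(1), of "\<ominus> e"] u(3) e by simp
          then have "c \<otimes> e \<in> P" using u(3) ce by simp
          then have "e \<in> C n" using reg[OF e] PC by blast
          moreover have "additive_subgroup (C n) R" using rC[of n] unfolding right_ideal_def by (rule conjunct1)
          ultimately show ?thesis unfolding ze by (intro additive_subgroup.a_closed u(2))
        qed
        then show False using Suc by blast
      qed
    qed
    moreover obtain N where N: "\<forall>n\<ge>N. C n = C N"
      using noeth rC mono unfolding right_noetherian_def by blast
    moreover have "C (Suc N) = C N" by (rule N[rule_format]) simp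
    ultimately show False by blast
  qed
  then show ?thesis unfolding regular_modulo_def using c reg by blast
qed

lemma (in ring) regular_in_ideal:
  assumes "noetherian R" "prime_ideal P R" "ideal E R" "\<not> E \<subseteq> P"
  obtains c where "c \<in> E" "regular_modulo R P c"
proof -
  obtain c where c: "c \<in> E" "\<And>x. x \<in> carrier R \<Longrightarrow> c \<otimes> x \<in> P \<Longrightarrow> x \<in> P"
    using right_regular_in_ideal[OF assms] by metis
  moreover have "regular_modulo R P c"
    using right_regular_imp_regular[OF _ assms(2)] c assms(1) ideal.Icarr[OF assms(3)]
    unfolding noetherian_def by blast
  ultimately show thesis using that by blast
qed

text \<open>
  If \<open>c x \<in> P\<close> and \<open>e \<in> E\<close>, then \<open>c x R e \<subseteq> P \<inter> E\<close>, so that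
  \<open>x R e \<subseteq> P\<close>, and some \<open>e\<close> is outside \<open>P\<close>.
\<close>

lemma (in ring) regular_modulo_component:
  assumes P: "prime_ideal P R" and E: "ideal E R" "\<not> E \<subseteq> P"
    and c: "regular_modulo R (P \<inter> E) c"
  shows "regular_modulo R P c"
proof -
  interpret P: ideal P R using P by (simp add: prime_ideal_def)
  interpret E: ideal E R by fact
  have cR: "c \<in> carrier R"
    and l: "\<And>x. x \<in> carrier R \<Longrightarrow> c \<otimes> x \<in> P \<inter> E \<Longrightarrow> x \<in> P \<inter> E"
    and r: "\<And>x. x \<in> carrier R \<Longrightarrow> x \<otimes> c \<in> P \<inter> E \<Longrightarrow> x \<in> P \<inter> E"
    using c unfolding regular_modulo_def by blast+
  obtain e where e: "e \<in> E" "e \<notin> P" using E(2) by blast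
  have eR: "e \<in> carrier R" using e by simp
  have "x \<in> P" if x: "x \<in> carrier R" "c \<otimes> x \<in> P" for x
  proof -
    have "x \<otimes> s \<otimes> e \<in> P" if s: "s \<in> carrier R" for s
    proof -
      have "c \<otimes> (x \<otimes> s \<otimes> e) = c \<otimes> x \<otimes> (s \<otimes> e)" using cR x s eR by (simp add: m_assoc)
      then have "c \<otimes> (x \<otimes> s \<otimes> e) \<in> P" using x s eR by (simp add: P.I_r_closed)
      moreover have "c \<otimes> (x \<otimes> s \<otimes> e) \<in> E" using cR x s e by (simp add: E.I_l_closed)
      ultimately show ?thesis using l[of "x \<otimes> s \<otimes> e"] x s eR by simp
    qed
    then show ?thesis using prime_ideal_elements[OF P x(1) eR] e(2) by blast
  qed
  moreover have "x \<in> P" if x: "x \<in> carrier R" "x \<otimes> c \<in> P" for x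
  proof -
    have "e \<otimes> s \<otimes> x \<in> P" if s: "s \<in> carrier R" for s
    proof -
      have "e \<otimes> s \<otimes> x \<otimes> c = e \<otimes> s \<otimes> (x \<otimes> c)" using cR x s eR by (simp add: m_assoc)
      then have "e \<otimes> s \<otimes> x \<otimes> c \<in> P" using x s eR by (simp add: P.I_l_closed)
      moreover have "e \<otimes> s \<otimes> x \<otimes> c \<in> E" using cR x s e by (simp add: E.I_r_closed)
      ultimately show ?thesis using r[of "e \<otimes> s \<otimes> x"] x s eR by simp
    qed
    then show ?thesis using prime_ideal_elements[OF P eR x(1)] e(2) by blast
  qed
  ultimately show ?thesis using cR unfolding regular_modulo_def by blast
qed


section \<open>Links in terms of elements\<close>

lemma (in ring) coset_eq_ideal_iff:
  assumes "ideal I R" "x \<in> carrier R"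
  shows "I +> x = I \<longleftrightarrow> x \<in> I"
proof -
  interpret I: ideal I R by fact
  show ?thesis
  proof
    assume "I +> x = I"
    then show "x \<in> I" using I.a_rcos_self[OF assms(2)] by simp
  qed (rule I.a_rcos_const)
qed

lemma (in ring) regular_element_quotient:
  assumes I: "ideal I R" and c: "c \<in> carrier R"
  shows "regular_element (R Quot I) (I +> c) \<longleftrightarrow> regular_modulo R I c"
proof -
  interpret I: ideal I R by fact
  have C: "carrier (R Quot I) = (\<lambda>r. I +> r) ` carrier R"
    by (auto simp: FactRing_def A_RCOSETS_def')
  have Z: "\<zero>\<^bsub>R Quot I\<^esub> = I" by (simp add: FactRing_def)
  have M: "(I +> r) \<otimes>\<^bsub>R Quot I\<^esub> (I +> s) = I +> (r \<otimes> s)" if "r \<in> carrier R" "s \<in> carrier R" for r s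
    using that by (simp add: FactRing_def I.rcoset_mult_add)
  show ?thesis
    using c by (auto simp: regular_element_def regular_modulo_def C Z M coset_eq_ideal_iff[OF I])
qed

lemma (in ring) ex_regular_element_quotient:
  assumes I: "ideal I R"
  shows "(\<exists>s. regular_element (R Quot I) s \<and> p s) \<longleftrightarrow> (\<exists>c. regular_modulo R I c \<and> p (I +> c))"
proof -
  have "carrier (R Quot I) = (\<lambda>r. I +> r) ` carrier R"
    by (auto simp: FactRing_def A_RCOSETS_def')
  then show ?thesis
    using regular_element_quotient[OF I] unfolding regular_element_def[of "R Quot I"]
      regular_modulo_def[of R I] by (smt (verit) imageE)
qed

lemma (in ring) torsionfree_left_quotient:
  assumes I: "ideal I R" and N: "ideal N R" and A: "ideal A R" and AN: "A \<subseteq> N" and IN: "I \<cdot> N \<subseteq> A"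
  shows "torsionfree (R Quot I) (left_quotient R N A) \<longleftrightarrow>
    (\<forall>c x. regular_modulo R I c \<longrightarrow> x \<in> N \<longrightarrow> c \<otimes> x \<in> A \<longrightarrow> x \<in> A)"
proof -
  interpret N: ideal N R by fact
  have C: "carrier (left_quotient R N A) = (\<lambda>x. A +> x) ` N" "\<zero>\<^bsub>left_quotient R N A\<^esub> = A"
    by (simp_all add: left_quotient_def)
  have c: "c \<in> carrier R" if "regular_modulo R I c" for c using that by (simp add: regular_modulo_def)
  show ?thesis
    unfolding torsionfree_def ex_regular_element_quotient[OF I] C
    using left_quotient_smult[OF assms] c
    by (auto simp: coset_eq_ideal_iff[OF A])
qed

lemma (in ring) torsionfree_right_quotient:
  assumes I: "ideal I R" and N: "ideal N R" and A: "ideal A R" and AN: "A \<subseteq> N" and NI: "N \<cdot> I \<subseteq> A"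
  shows "torsionfree (R Quot I) (right_quotient R N A) \<longleftrightarrow>
    (\<forall>c x. regular_modulo R I c \<longrightarrow> x \<in> N \<longrightarrow> x \<otimes> c \<in> A \<longrightarrow> x \<in> A)"
proof -
  interpret N: ideal N R by fact
  have C: "carrier (right_quotient R N A) = (\<lambda>x. A +> x) ` N" "\<zero>\<^bsub>right_quotient R N A\<^esub> = A"
    by (simp_all add: right_quotient_def)
  have c: "c \<in> carrier R" if "regular_modulo R I c" for c using that by (simp add: regular_modulo_def)
  show ?thesis
    unfolding torsionfree_def ex_regular_element_quotient[OF I] C
    using right_quotient_smult[OF assms] c
    by (auto simp: coset_eq_ideal_iff[OF A])
qed

lemma (in ring) link_iff_elements:
  assumes Q: "ideal Q R" and P: "ideal P R"
  shows "link R Q P \<longleftrightarrow> (\<exists>A. ideal A R \<and> Q \<cdot> P \<subseteq> A \<and> A \<subset> Q \<inter> P \<and>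
    (\<forall>c x. regular_modulo R Q c \<longrightarrow> x \<in> Q \<inter> P \<longrightarrow> c \<otimes> x \<in> A \<longrightarrow> x \<in> A) \<and>
    (\<forall>c x. regular_modulo R P c \<longrightarrow> x \<in> Q \<inter> P \<longrightarrow> x \<otimes> c \<in> A \<longrightarrow> x \<in> A))"
proof -
  have N: "ideal (Q \<inter> P) R" by (rule i_intersect[OF assms])
  have tf: "torsionfree (R Quot Q) (left_quotient R (Q \<inter> P) A) \<longleftrightarrow>
      (\<forall>c x. regular_modulo R Q c \<longrightarrow> x \<in> Q \<inter> P \<longrightarrow> c \<otimes> x \<in> A \<longrightarrow> x \<in> A)"
    "torsionfree (R Quot P) (right_quotient R (Q \<inter> P) A) \<longleftrightarrow>
      (\<forall>c x. regular_modulo R P c \<longrightarrow> x \<in> Q \<inter> P \<longrightarrow> x \<otimes> c \<in> A \<longrightarrow> x \<in> A)"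
    if A: "ideal A R" "Q \<cdot> P \<subseteq> A" "A \<subset> Q \<inter> P" for A
  proof -
    have "Q \<cdot> (Q \<inter> P) \<subseteq> A" "(Q \<inter> P) \<cdot> P \<subseteq> A"
      using ideal_prod_mono[of Q Q "Q \<inter> P" P] ideal_prod_mono[of "Q \<inter> P" Q P P] A by auto
    then show "torsionfree (R Quot Q) (left_quotient R (Q \<inter> P) A) \<longleftrightarrow>
      (\<forall>c x. regular_modulo R Q c \<longrightarrow> x \<in> Q \<inter> P \<longrightarrow> c \<otimes> x \<in> A \<longrightarrow> x \<in> A)"
      "torsionfree (R Quot P) (right_quotient R (Q \<inter> P) A) \<longleftrightarrow>
      (\<forall>c x. regular_modulo R P c \<longrightarrow> x \<in> Q \<inter> P \<longrightarrow> x \<otimes> c \<in> A \<longrightarrow> x \<in> A)"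
      using torsionfree_left_quotient[OF Q N A(1)] torsionfree_right_quotient[OF P N A(1)] A(3) by auto
  qed
  show ?thesis
    unfolding link_def by (intro ex_cong1 conj_cong refl) (rule tf, assumption+)+
qed

text \<open>
  The element \<open>d x e\<close> with \<open>d \<in> D\<close>, \<open>x \<in> Q \<inter> P\<close>, \<open>e \<in> E\<close> lies in all four ideals. If \<open>A\<close> contained their
  intersection, then regular \<open>d\<close> and \<open>e\<close> could be cancelled and \<open>A\<close> would contain \<open>Q \<inter> P\<close>.
\<close>

lemma (in ring) link_intersect:
  assumes noeth: "noetherian R" and Q: "prime_ideal Q R" and P: "prime_ideal P R"
    and D: "ideal D R" "\<not> D \<subseteq> Q" and E: "ideal E R" "\<not> E \<subseteq> P"
    and link: "link R Q P"
  shows "link R (Q \<inter> D) (P \<inter> E)"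
proof -
  have iQ: "ideal Q R" and iP: "ideal P R" using Q P by (simp_all add: prime_ideal_def)
  interpret Q: ideal Q R by (rule iQ)
  interpret P: ideal P R by (rule iP)
  interpret D: ideal D R by (rule D(1))
  interpret E: ideal E R by (rule E(1))
  have iQD: "ideal (Q \<inter> D) R" by (rule i_intersect[OF iQ D(1)])
  have iPE: "ideal (P \<inter> E) R" by (rule i_intersect[OF iP E(1)])
  obtain A where A: "ideal A R" "Q \<cdot> P \<subseteq> A" "A \<subset> Q \<inter> P"
    and l: "\<And>c x. regular_modulo R Q c \<Longrightarrow> x \<in> Q \<inter> P \<Longrightarrow> c \<otimes> x \<in> A \<Longrightarrow> x \<in> A"
    and r: "\<And>c x. regular_modulo R P c \<Longrightarrow> x \<in> Q \<inter> P \<Longrightarrow> x \<otimes> c \<in> A \<Longrightarrow> x \<in> A"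
    using link unfolding link_iff_elements[OF iQ iP] by blast
  define N where "N = (Q \<inter> D) \<inter> (P \<inter> E)"
  have N: "ideal N R" unfolding N_def by (rule i_intersect[OF iQD iPE])
  have "\<not> N \<subseteq> A"
  proof
    assume NA: "N \<subseteq> A"
    obtain d where d: "d \<in> D" "regular_modulo R Q d" using regular_in_ideal[OF noeth Q D] by metis
    obtain e where e: "e \<in> E" "regular_modulo R P e" using regular_in_ideal[OF noeth P E] by metis
    have "x \<in> A" if x: "x \<in> Q \<inter> P" for x
    proof -
      have c: "d \<in> carrier R" "e \<in> carrier R" "x \<in> carrier R" using d e x by auto
      have xe: "x \<otimes> e \<in> Q \<inter> P" using x c by (simp add: Q.I_r_closed P.I_r_closed)
      have "d \<otimes> (x \<otimes> e) \<in> Q \<inter> P" using xe c by (simp add: Q.I_l_closed P.I_l_closed)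
      moreover have "d \<otimes> (x \<otimes> e) \<in> D" using c d by (simp add: D.I_r_closed)
      moreover have "d \<otimes> (x \<otimes> e) \<in> E" using c e by (simp add: E.I_l_closed)
      ultimately have "d \<otimes> (x \<otimes> e) \<in> A" using NA by (auto simp: N_def)
      then have "x \<otimes> e \<in> A" using l[OF d(2) xe] by blast
      then show ?thesis using r[OF e(2) x] by blast
    qed
    then show False using A(3) by blast
  qed
  moreover have "(Q \<inter> D) \<cdot> (P \<inter> E) \<subseteq> N"
    by (rule ideal_prod_subset[OF N])
      (auto simp: N_def Q.I_r_closed D.I_r_closed P.I_l_closed E.I_l_closed)
  moreover have "(Q \<inter> D) \<cdot> (P \<inter> E) \<subseteq> A"
    using ideal_prod_mono[of "Q \<inter> D" Q "P \<inter> E" P] A(2) by auto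
  moreover have "ideal (A \<inter> N) R" by (rule i_intersect[OF A(1) N])
  moreover have "x \<in> A \<inter> N" if "regular_modulo R (Q \<inter> D) c" "x \<in> N" "c \<otimes> x \<in> A \<inter> N" for c x
    using l[OF regular_modulo_component[OF Q D that(1)], of x] that(2,3) by (auto simp: N_def)
  moreover have "x \<in> A \<inter> N" if "regular_modulo R (P \<inter> E) c" "x \<in> N" "x \<otimes> c \<in> A \<inter> N" for c x
    using r[OF regular_modulo_component[OF P E that(1)], of x] that(2,3) by (auto simp: N_def)
  ultimately show ?thesis
    unfolding link_iff_elements[OF iQD iPE] N_def[symmetric]
    by (intro exI[of _ "A \<inter> N"]) blast
qed


section \<open>Invariant parts of primes\<close>

text \<open>The carrier is intersected to cover a \<open>\<sigma>\<close>-invariant prime, which has no other conjugates.\<close>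

lemma (in ring) prime_avoids_finite_intersection:
  assumes P: "prime_ideal P R" and "finite F" "\<And>J. J \<in> F \<Longrightarrow> ideal J R \<and> \<not> J \<subseteq> P"
  shows "ideal (carrier R \<inter> \<Inter>F) R \<and> \<not> carrier R \<inter> \<Inter>F \<subseteq> P"
  using assms(2,3)
proof (induction F rule: finite_induct)
  case empty
  interpret P: ideal P R using P by (simp add: prime_ideal_def)
  show ?case using P oneideal P.a_subset by (auto simp: prime_ideal_def)
next
  case (insert J F)
  define B where "B = carrier R \<inter> \<Inter>F"
  have J: "ideal J R" "\<not> J \<subseteq> P" using insert.prems[OF insertI1] by blast+
  have B: "ideal B R" "\<not> B \<subseteq> P"
    using insert.IH[OF insert.prems[OF insertI2]] unfolding B_def by blast+
  interpret B: ideal B R by (rule B)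
  interpret J: ideal J R by (rule J)
  have "J \<cdot> B \<subseteq> J \<inter> B"
    by (rule ideal_prod_subset[OF i_intersect[OF J(1) B(1)]])
      (auto simp: J.I_r_closed B.I_l_closed)
  then have "\<not> J \<inter> B \<subseteq> P" using P B J unfolding prime_ideal_def by blast
  moreover have "carrier R \<inter> \<Inter>(insert J F) = J \<inter> B" by (auto simp: B_def)
  ultimately show ?case using i_intersect[OF J(1) B(1)] by simp
qed

text \<open>Applying \<open>\<sigma>\<^sup>i\<close> repeatedly gives a descending chain, which returns to \<open>P\<close> after \<open>n\<close> steps.\<close>

lemma conjugate_subset_imp_eq:
  assumes "n \<ge> 1" "(\<sigma> ^^ n) ` P = P" "(\<sigma> ^^ i) ` P \<subseteq> P"
  shows "(\<sigma> ^^ i) ` P = P"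
proof -
  have down: "(\<sigma> ^^ (i * Suc k)) ` P \<subseteq> (\<sigma> ^^ i) ` P" for k
  proof (induction k)
    case (Suc k)
    have "(\<sigma> ^^ (i * Suc (Suc k))) ` P = (\<sigma> ^^ i) ` ((\<sigma> ^^ (i * Suc k)) ` P)"
      by (simp add: funpow_add image_comp)
    then show ?case using Suc assms(3) by blast
  qed simp
  have "(\<sigma> ^^ (i * n)) ` P = P"
    using funpow_image_mult[OF assms(2), of i] by (simp add: mult.commute)
  then show ?thesis using down[of "n - 1"] assms(1,3) by simp
qed

lemma (in ring) invariant_part_split:
  assumes \<sigma>: "\<sigma> \<in> ring_iso R R" and P: "prime_ideal P R" and "semistable \<sigma> P"
  obtains E where "ideal E R" "\<not> E \<subseteq> P" "invariant_part \<sigma> P = P \<inter> E"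
proof -
  obtain n where n: "n \<ge> 1" "(\<sigma> ^^ n) ` P = P" using assms(3) by (auto simp: semistable_def)
  define F where "F = (\<lambda>i. (\<sigma> ^^ i) ` P) ` {..<n} - {P}"
  have "ideal J R \<and> \<not> J \<subseteq> P" if J: "J \<in> F" for J
  proof -
    obtain i where i: "J = (\<sigma> ^^ i) ` P" and "J \<noteq> P" using J by (auto simp: F_def)
    then show ?thesis
      using prime_ideal_image[OF ring_iso_funpow[OF \<sigma>] P, of i] conjugate_subset_imp_eq[OF n, of i]
      by (auto simp: prime_ideal_def)
  qed
  moreover have "finite F" by (simp add: F_def)
  ultimately have E: "ideal (carrier R \<inter> \<Inter>F) R" "\<not> carrier R \<inter> \<Inter>F \<subseteq> P"
    using prime_avoids_finite_intersection[OF P] by blast+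
  have "P \<in> (\<lambda>i. (\<sigma> ^^ i) ` P) ` {..<n}"
    using n(1) by (intro image_eqI[of _ _ 0]) auto
  then have conjugates: "(\<lambda>i. (\<sigma> ^^ i) ` P) ` {..<n} = insert P F" unfolding F_def by blast
  interpret P: ideal P R using P by (simp add: prime_ideal_def)
  have "invariant_part \<sigma> P = P \<inter> \<Inter>F" unfolding invariant_part_eq[OF n] conjugates by simp
  then have "invariant_part \<sigma> P = P \<inter> (carrier R \<inter> \<Inter>F)" using P.a_subset by blast
  then show thesis by (rule that[OF E])
qed

theorem mainTheorem1:
  fixes R :: "('a, 'b) ring_scheme" and \<sigma> :: "'a \<Rightarrow> 'a" and P Q :: "'a set"
  assumes "ring R" and "noetherian R"
    and "\<sigma> \<in> ring_iso R R"
    and "prime_ideal P R" and "prime_ideal Q R"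
    and "semistable \<sigma> P" and "semistable \<sigma> Q"
    and "link R Q P"
  shows "link R (invariant_part \<sigma> Q) (invariant_part \<sigma> P)"
proof -
  interpret ring R by fact
  obtain D where D: "ideal D R" "\<not> D \<subseteq> Q" "invariant_part \<sigma> Q = Q \<inter> D"
    using invariant_part_split[OF assms(3,5,7)] by metis
  obtain E where E: "ideal E R" "\<not> E \<subseteq> P" "invariant_part \<sigma> P = P \<inter> E"
    using invariant_part_split[OF assms(3,4,6)] by metis
  show ?thesis
    using link_intersect[OF assms(2,5,4) D(1,2) E(1,2) assms(8)] D(3) E(3) by simp
qed

end
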